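(* Let $\alpha\in\mathbb{R}$ and $f(x)=|x|^\alpha$, and let $M$ be a $k$-dimensional $f$-stationary submanifold in $\mathbb{R}^n$ or $\mathbb{R}^n\setminus\{0\}$, i.e. $$\mathbf{H}=\alpha|x|^{-2}x^\perp .\qquad( * )$$ Then: (1) If $\alpha>-k$, $M$ cannot be compact. (2) If $\alpha=-k$, then, as submanifolds in $\mathbb{R}^n$, all $k$-dimensional minimal submanifolds of the hyperspheres $S^{n-1}(R)=\{|x|=R\}$, $R>0$, satisfy $( * )$. (3) If $\alpha<-k$ and $M\subset\mathbb{R}^n\setminus\{0\}$ of class $C^2$ is $f$-stationary in $\mathbb{R}^n\setminus\{0\}$, then its closure $\overline{M}$ contains the origin.
   Context: $M$ is a (nonempty) $k$-dimensional $C^2$ submanifold embedded in $\mathbb{R}^n$, without boundary points included. $\mathbf{H}=\sum_{i=1}^k(D_{e_i}e_i)^\perp$ is its mean curvature vector (trace, not average, of the second fundamental form), with $e_1,\dots,e_k$ a local orthonormal tangent frame, $D$ the flat connection of $\mathbb{R}^n$ and $(\cdot)^\perp$ the normal projection; $x$ is the position vector. $M$ is $f$-stationary in an open set $U$ (where it is assumed that $U\cap M\ne\varnothing$ and $U\cap(\overline{M}\setminus M)=\varnothing$) if the first variation of $\mathcal{E}_f(M)=\int_Mf\,d\mathcal{H}_k$ vanishes for every deformation of $M$ compactly supported in $U$; for $C^2$ submanifolds and $f=|x|^\alpha$ this is equivalent to $( * )$ on $M\cap U$. *)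

theory Defs
  imports "HOL-Analysis.Analysis"
begin

definition C1_on :: "'a::real_normed_vector set \<Rightarrow> ('a \<Rightarrow> 'b::real_normed_vector) \<Rightarrow> bool"
  where "C1_on S f \<longleftrightarrow>
    (\<exists>f' :: 'a \<Rightarrow> 'a \<Rightarrow>\<^sub>L 'b.
      (\<forall>x\<in>S. (f has_derivative blinfun_apply (f' x)) (at x)) \<and> continuous_on S f')"

definition C2_on :: "'a::real_normed_vector set \<Rightarrow> ('a \<Rightarrow> 'b::real_normed_vector) \<Rightarrow> bool"
  where "C2_on S f \<longleftrightarrow>
    (\<exists>f' :: 'a \<Rightarrow> 'a \<Rightarrow>\<^sub>L 'b.
      (\<forall>x\<in>S. (f has_derivative blinfun_apply (f' x)) (at x)) \<and> C1_on S f')"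

text \<open>Nonempty embedded submanifolds without boundary, given by slice charts: near each of its
  points, \<open>M\<close> is mapped onto an open piece of a \<open>k\<close>-dimensional linear subspace by a
  \<open>C\<^sup>2\<close> diffeomorphism of open subsets of the ambient space. No closedness is required.\<close>

definition C2_submanifold :: "nat \<Rightarrow> 'a::euclidean_space set \<Rightarrow> bool"
  where "C2_submanifold k M \<longleftrightarrow> M \<noteq> {} \<and>
    (\<forall>p\<in>M. \<exists>V W (\<Phi> :: 'a \<Rightarrow> 'a) (\<Psi> :: 'a \<Rightarrow> 'a) L.
      open V \<and> p \<in> V \<and> open W \<and> homeomorphism V W \<Phi> \<Psi> \<and>
      C2_on V \<Phi> \<and> C2_on W \<Psi> \<and>
      subspace L \<and> dim L = k \<and> \<Phi> ` (M \<inter> V) = L \<inter> W)"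

text \<open>Velocities of curves in \<open>M\<close>. Only the germ of \<open>\<gamma>\<close> at \<open>0\<close> matters, so asking
  \<open>\<gamma>\<close> to stay in \<open>M\<close> for all times is no restriction.\<close>

definition tangent_space :: "'a::euclidean_space set \<Rightarrow> 'a \<Rightarrow> 'a set"
  where "tangent_space M p =
    {v. \<exists>\<gamma> :: real \<Rightarrow> 'a. \<gamma> 0 = p \<and> (\<forall>t. \<gamma> t \<in> M) \<and> (\<gamma> has_vector_derivative v) (at 0)}"

definition orth_proj :: "'a::euclidean_space set \<Rightarrow> 'a \<Rightarrow> 'a"
  where "orth_proj W v = (THE w. w \<in> W \<and> v - w \<in> orthogonal_comp W)"

definition normal_proj :: "'a::euclidean_space set \<Rightarrow> 'a \<Rightarrow> 'a \<Rightarrow> 'a"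
  where "normal_proj M p v = orth_proj (orthogonal_comp (tangent_space M p)) v"

text \<open>The fields \<open>e\<^sub>0, \<dots>, e\<^sub>k\<^sub>-\<^sub>1\<close> are represented by \<open>C\<^sup>1\<close> extensions to an open subset of
  the ambient space. They are tangent to \<open>M\<close> and orthonormal only along \<open>M\<close>.\<close>

definition orthonormal_tangent_frame ::
    "nat \<Rightarrow> 'a::euclidean_space set \<Rightarrow> 'a set \<Rightarrow> (nat \<Rightarrow> 'a \<Rightarrow> 'a) \<Rightarrow> bool"
  where "orthonormal_tangent_frame k M V e \<longleftrightarrow>
    open V \<and> (\<forall>i<k. C1_on V (e i)) \<and>
    (\<forall>x\<in>M \<inter> V. (\<forall>i<k. e i x \<in> tangent_space M x) \<and>
      (\<forall>i<k. \<forall>j<k. e i x \<bullet> e j x = (if i = j then 1 else 0)))"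

definition frame_near :: "nat \<Rightarrow> 'a::euclidean_space set \<Rightarrow> 'a \<Rightarrow> nat \<Rightarrow> 'a \<Rightarrow> 'a"
  where "frame_near k M p = (SOME e. \<exists>V. p \<in> V \<and> orthonormal_tangent_frame k M V e)"

definition flat_deriv :: "('a::euclidean_space \<Rightarrow> 'a) \<Rightarrow> ('a \<Rightarrow> 'a) \<Rightarrow> 'a \<Rightarrow> 'a"
  where "flat_deriv X Y p = frechet_derivative Y (at p) (X p)"

text \<open>The trace of the second fundamental form, not divided by \<open>k\<close>. At points of a
  \<open>C\<^sup>2\<close> submanifold, local frames exist and the value depends neither on the frame nor
  on its extension off \<open>M\<close>.\<close>

definition mean_curvature :: "nat \<Rightarrow> 'a::euclidean_space set \<Rightarrow> 'a \<Rightarrow> 'a"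
  where "mean_curvature k M p =
    (let e = frame_near k M p in \<Sum>i<k. normal_proj M p (flat_deriv (e i) (e i) p))"

text \<open>Mean curvature of \<open>M\<close> as a submanifold of a submanifold \<open>N\<close> of Euclidean space: the
  Levi-Civita connection of \<open>N\<close> is the tangential projection of the flat connection.\<close>

definition mean_curvature_in ::
    "nat \<Rightarrow> 'a::euclidean_space set \<Rightarrow> 'a set \<Rightarrow> 'a \<Rightarrow> 'a"
  where "mean_curvature_in k N M p =
    (let e = frame_near k M p in
      \<Sum>i<k. normal_proj M p (orth_proj (tangent_space N p) (flat_deriv (e i) (e i) p)))"

definition minimal_submanifold_of ::
    "nat \<Rightarrow> 'a::euclidean_space set \<Rightarrow> 'a set \<Rightarrow> bool"
  where "minimal_submanifold_of k N M \<longleftrightarrow>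
    C2_submanifold k M \<and> M \<subseteq> N \<and> (\<forall>p\<in>M. mean_curvature_in k N M p = 0)"

definition stationary_eq :: "nat \<Rightarrow> real \<Rightarrow> 'a::euclidean_space set \<Rightarrow> 'a \<Rightarrow> bool"
  where "stationary_eq k \<alpha> M x \<longleftrightarrow>
    mean_curvature k M x = (\<alpha> / (norm x)\<^sup>2) *\<^sub>R normal_proj M x x"

text \<open>Stationarity in \<open>U\<close> for the weight \<open>\<bar>x\<bar>\<^sup>\<alpha>\<close>, expressed for \<open>C\<^sup>2\<close> submanifolds by the
  equation \<open>H = \<alpha> \<bar>x\<bar>\<^sup>-\<^sup>2 x\<^sup>\<bottom>\<close>. The right-hand side is undefined at the origin, so nothing is
  demanded there, should the origin lie in \<open>M \<inter> U\<close>.\<close>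

definition f_stationary ::
    "nat \<Rightarrow> real \<Rightarrow> 'a::euclidean_space set \<Rightarrow> 'a set \<Rightarrow> bool"
  where "f_stationary k \<alpha> U M \<longleftrightarrow>
    open U \<and> U \<inter> M \<noteq> {} \<and> U \<inter> (closure M - M) = {} \<and>
    (\<forall>x \<in> M \<inter> U. x \<noteq> 0 \<longrightarrow> stationary_eq k \<alpha> M x)"

end

theory Submission
  imports Defs
begin

text \<open>At a point \<open>p\<close> of \<open>M\<close> where \<open>\<bar>x\<bar>\<close> is extremal along \<open>M\<close>, the vector \<open>p\<close> is normal to \<open>M\<close>, so
  pairing \<open>H = \<alpha> \<bar>x\<bar>\<^sup>-\<^sup>2 x\<^sup>\<bottom>\<close> with \<open>p\<close> gives \<open>H \<bullet> p = \<alpha>\<close>. On the other hand \<open>k + H \<bullet> p\<close> is the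
  Laplacian of \<open>\<bar>x\<bar>\<^sup>2 / 2\<close> on \<open>M\<close> at \<open>p\<close>. Hence \<open>k + \<alpha> \<le> 0\<close> at a maximum, which excludes compact
  \<open>M\<close> for \<open>\<alpha> > -k\<close>, and \<open>k + \<alpha> \<ge> 0\<close> at a minimum; if the origin is not in the closure, then \<open>M\<close> is
  closed and a minimum exists, which excludes \<open>\<alpha> < -k\<close>. For \<open>M\<close> in a sphere of radius \<open>R\<close>,
  differentiating \<open>e\<^sub>i \<bullet> x = 0\<close> along \<open>e\<^sub>i\<close> gives \<open>D e\<^sub>i e\<^sub>i \<bullet> x = -1\<close>, so the curvature vectors in the
  sphere and in Euclidean space differ by \<open>-k x / R\<^sup>2\<close>.\<close>

section \<open>Calculus of C^1 maps\<close>

text \<open>In finite dimensions a derivative that is continuous along each fixed direction is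
  continuous in operator norm, so \<open>C1_on\<close> can be checked on unbundled
  derivatives.\<close>

lemma C1_onI:
  fixes f :: "'a::euclidean_space \<Rightarrow> 'b::real_normed_vector"
  assumes D: "\<And>x. x \<in> S \<Longrightarrow> (f has_derivative D x) (at x)"
    and cont: "\<And>h. continuous_on S (\<lambda>x. D x h)"
  shows "C1_on S f"
proof -
  have *: "blinfun_apply (Blinfun (D x)) = D x" if "x \<in> S" for x
    using D[OF that] by (intro bounded_linear_Blinfun_apply has_derivative_bounded_linear)
  have "continuous_on S (\<lambda>x. Blinfun (D x))"
  proof (rule continuous_on_blinfun_componentwise)
    show "continuous_on S (\<lambda>x. blinfun_apply (Blinfun (D x)) i)" for i
      using cont[of i] by (simp add: * cong: continuous_on_cong)
  qed
  then show ?thesis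
    unfolding C1_on_def using D * by (intro exI[of _ "\<lambda>x. Blinfun (D x)"]) auto
qed

lemma C1_on_iff:
  fixes f :: "'a::euclidean_space \<Rightarrow> 'b::real_normed_vector"
  shows "C1_on S f \<longleftrightarrow>
    (\<exists>D. (\<forall>x\<in>S. (f has_derivative D x) (at x)) \<and> (\<forall>h. continuous_on S (\<lambda>x. D x h)))"
    (is "?l \<longleftrightarrow> ?r")
proof
  assume ?l
  then obtain f' :: "'a \<Rightarrow> 'a \<Rightarrow>\<^sub>L 'b" where "\<forall>x\<in>S. (f has_derivative f' x) (at x)" "continuous_on S f'"
    unfolding C1_on_def by blast
  then show ?r
    by (intro exI[of _ "\<lambda>x. blinfun_apply (f' x)"]) (auto intro!: continuous_intros)
qed (blast intro: C1_onI)

lemma C1_on_imp_continuous_on: "C1_on S f \<Longrightarrow> continuous_on S f"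
  unfolding C1_on_def
  by (blast intro: continuous_at_imp_continuous_on has_derivative_continuous)

lemma C1_on_bilinear:
  fixes f :: "'a::euclidean_space \<Rightarrow> 'b::real_normed_vector"
    and g :: "'a \<Rightarrow> 'c::real_normed_vector"
  assumes "bounded_bilinear b" "C1_on S f" "C1_on S g"
  shows "C1_on S (\<lambda>x. b (f x) (g x))"
proof -
  interpret bounded_bilinear b by fact
  obtain D where D: "\<And>x. x \<in> S \<Longrightarrow> (f has_derivative D x) (at x)" "\<And>h. continuous_on S (\<lambda>x. D x h)"
    using assms(2) unfolding C1_on_iff by blast
  obtain E where E: "\<And>x. x \<in> S \<Longrightarrow> (g has_derivative E x) (at x)" "\<And>h. continuous_on S (\<lambda>x. E x h)"
    using assms(3) unfolding C1_on_iff by blast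
  show ?thesis
    by (rule C1_onI[where D = "\<lambda>x h. b (f x) (E x h) + b (D x h) (g x)"])
      (intro FDERIV D E continuous_on continuous_on_add assms(2,3)[THEN C1_on_imp_continuous_on]; assumption)+
qed

lemmas C1_on_inner = C1_on_bilinear[OF bounded_bilinear_inner]
lemmas C1_on_scaleR = C1_on_bilinear[OF bounded_bilinear_scaleR]

lemma C1_on_diff:
  fixes f g :: "'a::euclidean_space \<Rightarrow> 'b::real_normed_vector"
  assumes "C1_on S f" "C1_on S g"
  shows "C1_on S (\<lambda>x. f x - g x)"
proof -
  obtain D where "\<And>x. x \<in> S \<Longrightarrow> (f has_derivative D x) (at x)" "\<And>h. continuous_on S (\<lambda>x. D x h)"
    using assms(1) unfolding C1_on_iff by blast
  moreover obtain E where "\<And>x. x \<in> S \<Longrightarrow> (g has_derivative E x) (at x)" "\<And>h. continuous_on S (\<lambda>x. E x h)"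
    using assms(2) unfolding C1_on_iff by blast
  ultimately show ?thesis
    by (intro C1_onI[where D = "\<lambda>x h. D x h - E x h"]) (auto intro!: derivative_intros continuous_intros)
qed

lemma C1_on_sum:
  fixes f :: "'i \<Rightarrow> 'a::euclidean_space \<Rightarrow> 'b::real_normed_vector"
  assumes "\<And>i. i \<in> I \<Longrightarrow> C1_on S (f i)"
  shows "C1_on S (\<lambda>x. \<Sum>i\<in>I. f i x)"
proof -
  have "\<forall>i\<in>I. \<exists>D. (\<forall>x\<in>S. (f i has_derivative D x) (at x)) \<and> (\<forall>h. continuous_on S (\<lambda>x. D x h))"
    using assms by (simp add: C1_on_iff)
  then obtain D where "\<And>i x. i \<in> I \<Longrightarrow> x \<in> S \<Longrightarrow> (f i has_derivative D i x) (at x)"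
    "\<And>i h. i \<in> I \<Longrightarrow> continuous_on S (\<lambda>x. D i x h)"
    unfolding bchoice_iff by blast
  then show ?thesis
    by (intro C1_onI[where D = "\<lambda>x h. \<Sum>i\<in>I. D i x h"])
      (auto intro!: derivative_intros continuous_intros)
qed

lemma C1_on_inverse_norm:
  fixes f :: "'a::euclidean_space \<Rightarrow> 'b::real_inner"
  assumes "C1_on S f" "\<And>x. x \<in> S \<Longrightarrow> f x \<noteq> 0"
  shows "C1_on S (\<lambda>x. inverse (norm (f x)))"
proof -
  obtain D where D: "\<And>x. x \<in> S \<Longrightarrow> (f has_derivative D x) (at x)" "\<And>h. continuous_on S (\<lambda>x. D x h)"
    using assms(1) unfolding C1_on_iff by blast
  have c: "continuous_on S f" using assms by (auto intro: C1_on_imp_continuous_on)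
  have n: "((\<lambda>x. norm (f x)) has_derivative (\<lambda>h. sgn (f x) \<bullet> D x h)) (at x)" if "x \<in> S" for x
    using has_derivative_compose[OF D(1)[OF that] has_derivative_norm[OF assms(2)[OF that]]]
    by (simp add: inner_commute)
  show ?thesis
  proof (rule C1_onI)
    show "((\<lambda>x. inverse (norm (f x))) has_derivative
        (\<lambda>h. - (inverse (norm (f x)) * (sgn (f x) \<bullet> D x h) * inverse (norm (f x))))) (at x)"
      if "x \<in> S" for x
      using assms(2)[OF that] n[OF that] by (intro Deriv.has_derivative_inverse) auto
    show "continuous_on S (\<lambda>x. - (inverse (norm (f x)) * (sgn (f x) \<bullet> D x h) * inverse (norm (f x))))" for h
      unfolding sgn_div_norm using c D(2) assms(2) by (intro continuous_intros) auto
  qed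
qed

text \<open>The Gram-Schmidt process, run at every \<open>x\<close> at once, uses only inner
  products, sums and division by norms, all of which preserve C^1 regularity. Independence of each
  field from the earlier ones keeps the norms nonzero.\<close>

lemma C1_orthonormalization:
  fixes X :: "nat \<Rightarrow> 'a::euclidean_space \<Rightarrow> 'b::euclidean_space"
  assumes X: "\<And>i. i < k \<Longrightarrow> C1_on V (X i)"
    and indep: "\<And>x i. x \<in> V \<Longrightarrow> i < k \<Longrightarrow> X i x \<notin> span ((\<lambda>j. X j x) ` {..<i})"
  obtains e where "\<And>i. i < k \<Longrightarrow> C1_on V (e i)"
    and "\<And>x i. x \<in> V \<Longrightarrow> i < k \<Longrightarrow> e i x \<in> span ((\<lambda>j. X j x) ` {..<k})"
    and "\<And>x i j. x \<in> V \<Longrightarrow> i < k \<Longrightarrow> j < k \<Longrightarrow> e i x \<bullet> e j x = (if i = j then 1 else 0)"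
proof -
  have "m \<le> k \<Longrightarrow> \<exists>e. (\<forall>i<m. C1_on V (e i)) \<and> (\<forall>x\<in>V. \<forall>i<m. e i x \<in> span ((\<lambda>j. X j x) ` {..<m}) \<and>
     (\<forall>j<m. e i x \<bullet> e j x = (if i = j then 1 else 0)))" for m
  proof (induction m)
    case 0
    then show ?case by auto
  next
    case (Suc m)
    then obtain e where C1: "\<And>i. i < m \<Longrightarrow> C1_on V (e i)"
      and span: "\<And>x i. x \<in> V \<Longrightarrow> i < m \<Longrightarrow> e i x \<in> span ((\<lambda>j. X j x) ` {..<m})"
      and orth: "\<And>x i j. x \<in> V \<Longrightarrow> i < m \<Longrightarrow> j < m \<Longrightarrow> e i x \<bullet> e j x = (if i = j then 1 else 0)"
      by (metis Suc_leD)
    \<comment> \<open>The component of \<open>X m\<close> orthogonal to the fields already built,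
      before normalisation.\<close>
    define w where "w x = X m x - (\<Sum>j<m. (X m x \<bullet> e j x) *\<^sub>R e j x)" for x
    define e' where "e' = e(m := \<lambda>x. inverse (norm (w x)) *\<^sub>R w x)"
    have w0: "w x \<noteq> 0" if "x \<in> V" for x
    proof
      assume "w x = 0"
      then have "X m x = (\<Sum>j<m. (X m x \<bullet> e j x) *\<^sub>R e j x)" by (simp add: w_def)
      also have "\<dots> \<in> span ((\<lambda>j. X j x) ` {..<m})"
        using span that by (intro span_sum span_scale) auto
      finally show False using indep[OF that, of m] Suc.prems by auto
    qed
    have w_orth: "w x \<bullet> e i x = 0" if "x \<in> V" "i < m" for x i
    proof -
      have "(\<Sum>j<m. (X m x \<bullet> e j x) * (e j x \<bullet> e i x)) = (\<Sum>j<m. if j = i then X m x \<bullet> e i x else 0)"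
        using orth that by (intro sum.cong) auto
      then show ?thesis
        using that by (simp add: w_def inner_diff_left inner_sum_left)
    qed
    have "C1_on V w"
      unfolding w_def using Suc.prems
      by (intro C1_on_diff C1_on_sum C1_on_scaleR C1_on_inner C1 X) auto
    then have "C1_on V (e' i)" if "i < Suc m" for i
      using that C1 w0 by (auto simp: e'_def less_Suc_eq intro!: C1_on_scaleR C1_on_inverse_norm)
    moreover have "e' i x \<in> span ((\<lambda>j. X j x) ` {..<Suc m})" if "x \<in> V" "i < Suc m" for x i
    proof -
      have sub: "span ((\<lambda>j. X j x) ` {..<m}) \<subseteq> span ((\<lambda>j. X j x) ` {..<Suc m})"
        by (intro span_mono) auto
      then have "w x \<in> span ((\<lambda>j. X j x) ` {..<Suc m})"
        unfolding w_def using span \<open>x \<in> V\<close> by (intro span_diff span_sum span_scale) (auto intro: span_base)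
      then show ?thesis
        using that sub span by (auto simp: e'_def less_Suc_eq intro!: span_scale)
    qed
    moreover have "e' i x \<bullet> e' j x = (if i = j then 1 else 0)" if "x \<in> V" "i < Suc m" "j < Suc m" for x i j
    proof -
      have "inverse (norm (w x)) * (inverse (norm (w x)) * (w x \<bullet> w x)) = 1"
        using w0[OF \<open>x \<in> V\<close>] by (simp add: dot_square_norm power2_eq_square field_simps)
      then show ?thesis
        using that orth w_orth by (auto simp: e'_def less_Suc_eq inner_commute)
    qed
    ultimately show ?case by (intro exI[of _ e']) auto
  qed
  from this[of k] obtain e where "\<forall>i<k. C1_on V (e i)"
    "\<forall>x\<in>V. \<forall>i<k. e i x \<in> span ((\<lambda>j. X j x) ` {..<k}) \<and> (\<forall>j<k. e i x \<bullet> e j x = (if i = j then 1 else 0))"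
    by auto
  then show ?thesis by (intro that[of e]) blast+
qed

section \<open>Orthogonal projections and orthonormal bases\<close>

text \<open>Two candidates differ by a vector lying both in \<open>W\<close> and in its complement,
  hence orthogonal to itself. This makes the definite description in \<open>orth_proj\<close>
  usable.\<close>

lemma orth_proj_eqI:
  fixes W :: "'a::euclidean_space set"
  assumes "subspace W" "w \<in> W" "v - w \<in> W\<^sup>\<bottom>"
  shows "orth_proj W v = w"
  unfolding orth_proj_def
proof (rule the_equality)
  fix u assume u: "u \<in> W \<and> v - u \<in> W\<^sup>\<bottom>"
  have "(v - w) - (v - u) \<in> W\<^sup>\<bottom>" 
    using u assms(3) by (blast intro: subspace_diff[OF subspace_orthogonal_comp])
  moreover have "u - w \<in> W" using u assms by (auto intro: subspace_diff)
  ultimately have "(u - w) \<bullet> (u - w) = 0"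
    unfolding orthogonal_comp_def orthogonal_def by auto
  then show "u = w" by simp
qed (use assms in auto)

lemma orth_proj_props:
  fixes W :: "'a::euclidean_space set"
  assumes "subspace W"
  shows "orth_proj W v \<in> W" "v - orth_proj W v \<in> W\<^sup>\<bottom>"
proof -
  obtain y z where yz: "y \<in> span W" "\<And>w. w \<in> span W \<Longrightarrow> orthogonal z w" "v = y + z"
    using orthogonal_subspace_decomp_exists[of W v] by blast
  then have "y \<in> W" "v - y \<in> W\<^sup>\<bottom>"
    using assms by (auto simp: orthogonal_comp_def orthogonal_commute span_eq_iff[THEN iffD2])
  with orth_proj_eqI[OF assms] show "orth_proj W v \<in> W" "v - orth_proj W v \<in> W\<^sup>\<bottom>" by metis+
qed

lemma linear_orth_proj:
  fixes W :: "'a::euclidean_space set"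
  assumes "subspace W"
  shows "linear (orth_proj W)"
proof (rule linearI)
  note sub = subspace_orthogonal_comp[of W]
  fix u v
  have "(u - orth_proj W u) + (v - orth_proj W v) \<in> W\<^sup>\<bottom>"
    using sub orth_proj_props[OF assms] by (intro subspace_add) auto
  then show "orth_proj W (u + v) = orth_proj W u + orth_proj W v"
    using orth_proj_props[OF assms] assms by (intro orth_proj_eqI) (auto intro: subspace_add simp: algebra_simps)
  fix c
  have "c *\<^sub>R (u - orth_proj W u) \<in> W\<^sup>\<bottom>"
    using sub orth_proj_props[OF assms] by (intro subspace_scale) auto
  then show "orth_proj W (c *\<^sub>R u) = c *\<^sub>R orth_proj W u"
    using orth_proj_props[OF assms] assms by (intro orth_proj_eqI) (auto intro: subspace_scale simp: algebra_simps)
qed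

lemma linear_normal_proj: "linear (normal_proj M p)"
  unfolding normal_proj_def[abs_def] by (intro linear_orth_proj subspace_orthogonal_comp)

text \<open>What the projection removes is orthogonal to every normal vector. The projections inside
  \<open>mean_curvature\<close> therefore disappear when it is paired with a normal
  \<open>p\<close>.\<close>

lemma normal_proj_normal:
  assumes "p \<in> (tangent_space M q)\<^sup>\<bottom>"
  shows "normal_proj M q p = p" and "normal_proj M q w \<bullet> p = w \<bullet> p"
proof -
  note sub = subspace_orthogonal_comp[of "tangent_space M q"]
  show "normal_proj M q p = p"
    unfolding normal_proj_def using sub assms by (intro orth_proj_eqI) (auto simp: orthogonal_comp_def orthogonal_def)
  have "orthogonal p (w - normal_proj M q w)"
    using orth_proj_props(2)[OF sub, of w] assms unfolding normal_proj_def orthogonal_comp_def by blast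
  then show "normal_proj M q w \<bullet> p = w \<bullet> p"
    by (simp add: orthogonal_def inner_diff_right inner_commute)
qed


text \<open>By dimension count the \<open>k\<close> orthonormal vectors span \<open>T\<close>; the
  remainder of the expansion lies in \<open>T\<close> and is orthogonal to all of them, so it is
  zero.\<close>

lemma orthonormal_expansion:
  fixes e :: "nat \<Rightarrow> 'a::euclidean_space"
  assumes T: "subspace T" "dim T = k"
    and e: "\<And>i. i < k \<Longrightarrow> e i \<in> T"
    and orth: "\<And>i j. i < k \<Longrightarrow> j < k \<Longrightarrow> e i \<bullet> e j = (if i = j then 1 else 0)"
    and v: "v \<in> T"
  shows "v = (\<Sum>i<k. (v \<bullet> e i) *\<^sub>R e i)"
proof -
  have inj: "inj_on e {..<k}"
    using orth by (metis inj_onI lessThan_iff zero_neq_one)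
  have "pairwise orthogonal (e ` {..<k})"
    using orth by (auto simp: pairwise_def orthogonal_def)
  moreover have "0 \<notin> e ` {..<k}"
    using orth by (metis imageE inner_zero_left lessThan_iff zero_neq_one)
  ultimately have "independent (e ` {..<k})"
    by (rule pairwise_orthogonal_independent)
  then have span: "T \<subseteq> span (e ` {..<k})"
    using e T inj by (subst card_eq_dim[symmetric]) (auto simp: card_image)
  define w where "w = v - (\<Sum>i<k. (v \<bullet> e i) *\<^sub>R e i)"
  have "w \<bullet> e j = 0" if "j < k" for j
  proof -
    have "(\<Sum>i<k. (v \<bullet> e i) * (e i \<bullet> e j)) = (\<Sum>i<k. if i = j then v \<bullet> e j else 0)"
      using orth that by (intro sum.cong) auto
    then show ?thesis
      using that by (simp add: w_def inner_diff_left inner_sum_left)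
  qed
  moreover have "w \<in> T"
    unfolding w_def using T v e by (auto intro!: subspace_diff subspace_sum subspace_scale)
  ultimately have "orthogonal w w"
    using span by (intro orthogonal_to_span[of w "e ` {..<k}" w]) (auto simp: orthogonal_def)
  then have "w = 0" by (simp add: orthogonal_self)
  then show ?thesis by (simp add: w_def)
qed

section \<open>One-variable calculus and curves\<close>

text \<open>Since \<open>b x = 0\<close>, the Caratheodory slope \<open>h\<close> of
  \<open>b\<close> gives \<open>a t * b t = (a t * h t) * (t - x)\<close>, and
  \<open>a t * h t\<close> is continuous at \<open>x\<close>. The factor \<open>a\<close> enters
  through its continuity alone.\<close>

lemma DERIV_mult_zero:
  fixes a b :: "real \<Rightarrow> real"
  assumes "isCont a x" "DERIV b x :> d" "b x = 0"
  shows "DERIV (\<lambda>t. a t * b t) x :> a x * d"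
proof -
  obtain h where h: "\<And>t. b t - b x = h t * (t - x)" "isCont h x" "h x = d"
    using assms(2) by (auto simp: CARAT_DERIV)
  show ?thesis
    unfolding CARAT_DERIV using h assms
    by (intro exI[of _ "\<lambda>t. a t * h t"]) (auto intro!: continuous_intros)
qed

text \<open>If \<open>c\<close> were positive, \<open>G\<close>, which vanishes at 0 by maximality,
  would be positive just to the right, and the mean value theorem would give a value of
  \<open>g\<close> above \<open>g 0\<close>. Differentiability of \<open>G\<close> is asked for at 0
  only, as \<open>DERIV_mult_zero\<close> supplies it.\<close>

lemma second_derivative_nonpos_at_max:
  fixes g G :: "real \<Rightarrow> real"
  assumes "\<delta> > 0"
    and g: "\<And>t. \<bar>t\<bar> < \<delta> \<Longrightarrow> DERIV g t :> G t"
    and max: "\<And>t. \<bar>t\<bar> < \<delta> \<Longrightarrow> g t \<le> g 0"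
    and G: "DERIV G 0 :> c"
  shows "c \<le> 0"
proof (rule ccontr)
  assume "\<not> c \<le> 0"
  then obtain d where d: "d > 0" "\<And>h. h > 0 \<Longrightarrow> h < d \<Longrightarrow> G 0 < G h"
    using DERIV_pos_inc_right[OF G] by auto
  have G0: "G 0 = 0"
    using DERIV_local_max[OF g[of 0] \<open>\<delta> > 0\<close>] max \<open>\<delta> > 0\<close> by auto
  define h where "h = min d \<delta> / 2"
  have h: "0 < h" "h < d" "h < \<delta>" using d \<open>\<delta> > 0\<close> by (auto simp: h_def)
  obtain z where z: "0 < z" "z < h" "g h - g 0 = (h - 0) * G z"
    using MVT2[of 0 h g G] g h by auto
  have "G z > 0" using d(2)[of z] z h G0 by auto
  then have "g h > g 0" using z h by (smt (verit) mult_pos_pos)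
  then show False using max[of h] h by auto
qed

lemma has_vector_derivative_compose:
  assumes "(\<gamma> has_vector_derivative v) (at t)" "(f has_derivative f') (at (\<gamma> t))"
  shows "((\<lambda>t. f (\<gamma> t)) has_vector_derivative f' v) (at t)"
proof -
  have "f' (h *\<^sub>R v) = h *\<^sub>R f' v" for h
    using has_derivative_linear[OF assms(2)] by (rule linear_cmul)
  then show ?thesis
    using has_derivative_compose[OF assms(1)[unfolded has_vector_derivative_def] assms(2)]
    by (simp add: has_vector_derivative_def)
qed

text \<open>The curve is shifted to time 0 and replaced by the constant \<open>p\<close> away from
  it, because \<open>tangent_space\<close> asks for curves that stay in \<open>M\<close> at all
  times.\<close>

lemma tangent_spaceI:
  assumes \<gamma>: "(\<gamma> has_vector_derivative v) (at s)" "\<gamma> s = p"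
    and \<delta>: "\<delta> > 0" "\<And>t. \<bar>t - s\<bar> < \<delta> \<Longrightarrow> \<gamma> t \<in> M"
  shows "v \<in> tangent_space M p"
proof -
  define \<eta> where "\<eta> t = (if \<bar>t\<bar> < \<delta> then \<gamma> (t + s) else p)" for t
  have "((\<lambda>t. t + s) has_vector_derivative 1) (at 0)"
    by (auto intro!: derivative_eq_intros)
  then have "((\<lambda>t. \<gamma> (t + s)) has_vector_derivative v) (at 0)"
    using vector_diff_chain_at[of "\<lambda>t. t + s" 1 0 \<gamma> v] \<gamma>(1) by (simp add: o_def)
  then have "(\<eta> has_vector_derivative v) (at 0)"
    by (rule has_vector_derivative_transform_within_open[where S = "{-\<delta><..<\<delta>}"])
      (use \<delta> in \<open>auto simp: \<eta>_def\<close>)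
  moreover have "\<eta> t \<in> M" for t
    using \<delta>(2)[of "t + s"] \<delta>(2)[of s] \<delta>(1) \<gamma>(2) by (auto simp: \<eta>_def)
  ultimately show ?thesis
    using \<delta> \<gamma> unfolding tangent_space_def by (auto intro!: exI[of _ \<eta>] simp: \<eta>_def)
qed

section \<open>Slice charts, tangent spaces and local frames\<close>

text \<open>One chart from \<open>C2_submanifold\<close> with its derivatives named. Frame fields
  are built from \<open>\<Psi>'\<close>, hence its C^1 regularity; \<open>\<Phi>'\<close> enters
  their derivatives through the chain rule, hence its continuity.\<close>

locale slice_chart =
  fixes k :: nat and M V W L :: "'a::euclidean_space set"
    and \<Phi> \<Psi> :: "'a \<Rightarrow> 'a" and \<Phi>' \<Psi>' :: "'a \<Rightarrow> 'a \<Rightarrow>\<^sub>L 'a"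
  assumes open_V: "open V" and open_W: "open W" and homeo: "homeomorphism V W \<Phi> \<Psi>"
    and der_\<Phi>: "\<And>x. x \<in> V \<Longrightarrow> (\<Phi> has_derivative \<Phi>' x) (at x)"
    and der_\<Psi>: "\<And>y. y \<in> W \<Longrightarrow> (\<Psi> has_derivative \<Psi>' y) (at y)"
    and cont_\<Phi>': "continuous_on V \<Phi>'" and C1_\<Psi>': "C1_on W \<Psi>'"
    and subspace_L: "subspace L" and dim_L: "dim L = k"
    and slice: "\<Phi> ` (M \<inter> V) = L \<inter> W"

lemma C2_submanifold_chart:
  fixes M :: "'a::euclidean_space set"
  assumes "C2_submanifold k M" "p \<in> M"
  obtains V W L \<Phi> \<Psi> \<Phi>' \<Psi>' where "slice_chart k M V W L \<Phi> \<Psi> \<Phi>' \<Psi>'" "p \<in> V"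
proof -
  obtain V W and \<Phi> \<Psi> :: "'a \<Rightarrow> 'a" and L where *: "open V" "p \<in> V" "open W" "homeomorphism V W \<Phi> \<Psi>"
      "C2_on V \<Phi>" "C2_on W \<Psi>" "subspace L" "dim L = k" "\<Phi> ` (M \<inter> V) = L \<inter> W"
    using assms unfolding C2_submanifold_def
    by (elim conjE) (drule bspec, assumption, elim exE conjE, rule that, assumption+)
  obtain \<Phi>' where \<Phi>': "\<forall>x\<in>V. (\<Phi> has_derivative blinfun_apply (\<Phi>' x)) (at x)" "C1_on V \<Phi>'"
    using *(5) unfolding C2_on_def by blast
  obtain \<Psi>' where \<Psi>': "\<forall>x\<in>W. (\<Psi> has_derivative blinfun_apply (\<Psi>' x)) (at x)" "C1_on W \<Psi>'"
    using *(6) unfolding C2_on_def by blast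
  have "slice_chart k M V W L \<Phi> \<Psi> \<Phi>' \<Psi>'"
    using * \<Phi>' \<Psi>' C1_on_imp_continuous_on by unfold_locales auto
  then show ?thesis using that * by blast
qed

context slice_chart
begin

lemma chart_maps:
  "x \<in> V \<Longrightarrow> \<Phi> x \<in> W" "x \<in> V \<Longrightarrow> \<Psi> (\<Phi> x) = x"
  "y \<in> W \<Longrightarrow> \<Psi> y \<in> V" "y \<in> W \<Longrightarrow> \<Phi> (\<Psi> y) = y"
  using homeo unfolding homeomorphism_def by auto

lemma mem_iff:
  assumes "x \<in> V"
  shows "x \<in> M \<longleftrightarrow> \<Phi> x \<in> L"
proof
  assume "x \<in> M"
  then show "\<Phi> x \<in> L" using assms slice by blast
next
  assume "\<Phi> x \<in> L"
  then have "\<Phi> x \<in> \<Phi> ` (M \<inter> V)" using slice chart_maps(1)[OF assms] by blast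
  then obtain y where "y \<in> M" "y \<in> V" "\<Phi> x = \<Phi> y" by blast
  then show "x \<in> M" using chart_maps(2) assms by metis
qed

lemma \<Psi>'_\<Phi>':
  assumes "x \<in> V"
  shows "\<Psi>' (\<Phi> x) (\<Phi>' x h) = h"
proof -
  have "((\<lambda>x. \<Psi> (\<Phi> x)) has_derivative (\<lambda>h. \<Psi>' (\<Phi> x) (\<Phi>' x h))) (at x)"
    using der_\<Phi>[OF assms] der_\<Psi>[OF chart_maps(1)[OF assms]] by (rule has_derivative_compose)
  moreover have "((\<lambda>x. \<Psi> (\<Phi> x)) has_derivative (\<lambda>h. h)) (at x)"
    by (rule has_derivative_transform_within_open[OF has_derivative_ident open_V assms])
      (simp add: chart_maps)
  ultimately show ?thesis by (metis has_derivative_unique)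
qed

lemma \<Phi>'_\<Psi>':
  assumes "x \<in> V"
  shows "\<Phi>' x (\<Psi>' (\<Phi> x) h) = h"
proof -
  note y = chart_maps(1)[OF assms]
  have "((\<lambda>y. \<Phi> (\<Psi> y)) has_derivative (\<lambda>h. \<Phi>' (\<Psi> (\<Phi> x)) (\<Psi>' (\<Phi> x) h))) (at (\<Phi> x))"
    using der_\<Psi>[OF y] der_\<Phi>[OF chart_maps(3)[OF y]] by (rule has_derivative_compose)
  moreover have "((\<lambda>y. \<Phi> (\<Psi> y)) has_derivative (\<lambda>h. h)) (at (\<Phi> x))"
    by (rule has_derivative_transform_within_open[OF has_derivative_ident open_W y])
      (simp add: chart_maps)
  ultimately show ?thesis using chart_maps(2)[OF assms] by (metis has_derivative_unique)
qed

text \<open>The line through \<open>\<Phi> x\<close> in direction \<open>c\<close> stays in the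
  subspace \<open>L\<close>, and for short times in the open set \<open>W\<close>, so
  \<open>\<Psi>\<close> carries it into \<open>M\<close>. These curves realise tangent vectors and
  later serve as test curves at an extremum.\<close>

lemma chart_curve:
  assumes "x \<in> M" "x \<in> V" "c \<in> L"
  obtains \<delta> where "\<delta> > 0" "\<forall>t. \<bar>t\<bar> < \<delta> \<longrightarrow> \<Phi> x + t *\<^sub>R c \<in> W"
    "\<forall>t. \<bar>t\<bar> < \<delta> \<longrightarrow> \<Psi> (\<Phi> x + t *\<^sub>R c) \<in> M"
    "\<forall>t. \<bar>t\<bar> < \<delta> \<longrightarrow>
      ((\<lambda>t. \<Psi> (\<Phi> x + t *\<^sub>R c)) has_vector_derivative \<Psi>' (\<Phi> x + t *\<^sub>R c) c) (at t)"
proof -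
  have "open ((\<lambda>t::real. \<Phi> x + t *\<^sub>R c) -` W)"
    using open_W by (intro open_vimage continuous_intros)
  then obtain \<delta> where \<delta>: "\<delta> > 0" "ball 0 \<delta> \<subseteq> (\<lambda>t::real. \<Phi> x + t *\<^sub>R c) -` W"
    using open_contains_ball_eq[of _ "0::real"] chart_maps(1)[OF assms(2)] by force
  then have W: "\<Phi> x + t *\<^sub>R c \<in> W" if "\<bar>t\<bar> < \<delta>" for t
    using that by (auto simp: subset_iff)
  have "\<Psi> (\<Phi> x + t *\<^sub>R c) \<in> M" if "\<bar>t\<bar> < \<delta>" for t
  proof -
    have "\<Phi> x + t *\<^sub>R c \<in> L"
      using assms mem_iff subspace_L by (intro subspace_add subspace_scale) auto
    then show ?thesis using mem_iff chart_maps W[OF that] by simp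
  qed
  moreover have "((\<lambda>t. \<Psi> (\<Phi> x + t *\<^sub>R c)) has_vector_derivative \<Psi>' (\<Phi> x + t *\<^sub>R c) c) (at t)"
    if "\<bar>t\<bar> < \<delta>" for t
  proof -
    have "((\<lambda>t. \<Phi> x + t *\<^sub>R c) has_vector_derivative c) (at t)"
      by (auto intro!: derivative_eq_intros)
    from has_vector_derivative_compose[OF this der_\<Psi>[OF W[OF that]]] show ?thesis .
  qed
  ultimately show ?thesis using \<delta>(1) W by (intro that[of \<delta>]) auto
qed

text \<open>In the chart a curve in \<open>M\<close> becomes a curve in \<open>L\<close>, whose
  velocity again lies in \<open>L\<close>; conversely every direction of \<open>L\<close> is the
  velocity of a straight segment.\<close>

lemma tangent_space_eq:
  assumes x: "x \<in> M" "x \<in> V"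
  shows "tangent_space M x = \<Psi>' (\<Phi> x) ` L"
proof (intro equalityI subsetI)
  fix v assume "v \<in> tangent_space M x"
  then obtain \<gamma> where \<gamma>: "\<gamma> 0 = x" "\<And>t. \<gamma> t \<in> M" "(\<gamma> has_vector_derivative v) (at 0)"
    unfolding tangent_space_def by blast
  have "isCont \<gamma> 0" using \<gamma>(3) by (rule has_vector_derivative_continuous)
  then have "\<forall>\<^sub>F t in nhds 0. \<gamma> t \<in> V"
    using open_V x \<gamma>(1) by (auto simp: isCont_def tendsto_at_iff_tendsto_nhds dest: topological_tendstoD)
  then obtain S where S: "open S" "0 \<in> S" "\<And>t. t \<in> S \<Longrightarrow> \<gamma> t \<in> V"
    unfolding eventually_nhds by blast
  have d: "((\<lambda>t. \<Phi> (\<gamma> t)) has_vector_derivative \<Phi>' x v) (at 0)"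
    using has_vector_derivative_compose[OF \<gamma>(3), unfolded \<gamma>(1), OF der_\<Phi>[OF x(2)]] .
  \<comment> \<open>A normal vector \<open>w\<close> of \<open>L\<close> pairs to zero with the
    curve near time 0, hence with its velocity. As \<open>L\<close> is its own double complement,
    the velocity lies in \<open>L\<close>.\<close>
  have "w \<bullet> \<Phi>' x v = 0" if w: "w \<in> L\<^sup>\<bottom>" for w
  proof -
    have "((\<lambda>t. w \<bullet> \<Phi> (\<gamma> t)) has_vector_derivative w \<bullet> \<Phi>' x v) (at 0)"
      using d by (rule bounded_linear.has_vector_derivative[OF bounded_linear_inner_right])
    moreover have "((\<lambda>t. w \<bullet> \<Phi> (\<gamma> t)) has_vector_derivative 0) (at 0)"
    proof (rule has_vector_derivative_transform_within_open[OF has_vector_derivative_const S(1,2)])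
      fix t assume "t \<in> S"
      then have "\<Phi> (\<gamma> t) \<in> L" using S \<gamma> mem_iff by blast
      then show "0 = w \<bullet> \<Phi> (\<gamma> t)"
        using w by (auto simp: orthogonal_comp_def orthogonal_def inner_commute)
    qed
    ultimately show ?thesis by (rule vector_derivative_unique_at)
  qed
  then have "\<Phi>' x v \<in> L\<^sup>\<bottom>\<^sup>\<bottom>"
    unfolding orthogonal_comp_def[of "L\<^sup>\<bottom>"] orthogonal_def by blast
  then have "\<Phi>' x v \<in> L" using orthogonal_comp_self subspace_L by blast
  then show "v \<in> \<Psi>' (\<Phi> x) ` L" using \<Psi>'_\<Phi>'[OF x(2), of v] by (metis imageI)
next
  fix v assume "v \<in> \<Psi>' (\<Phi> x) ` L"
  then obtain c where c: "c \<in> L" "v = \<Psi>' (\<Phi> x) c" by blast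
  obtain \<delta> where \<delta>: "\<delta> > 0" "\<forall>t. \<bar>t\<bar> < \<delta> \<longrightarrow> \<Phi> x + t *\<^sub>R c \<in> W"
    "\<forall>t. \<bar>t\<bar> < \<delta> \<longrightarrow> \<Psi> (\<Phi> x + t *\<^sub>R c) \<in> M"
    "\<forall>t. \<bar>t\<bar> < \<delta> \<longrightarrow>
      ((\<lambda>t. \<Psi> (\<Phi> x + t *\<^sub>R c)) has_vector_derivative \<Psi>' (\<Phi> x + t *\<^sub>R c) c) (at t)"
    by (rule chart_curve[OF x c(1)])
  show "v \<in> tangent_space M x"
    using \<delta>(4)[rule_format, of 0] c \<delta>(1,3) chart_maps(2)[OF x(2)] by (intro tangent_spaceI[of "\<lambda>t. \<Psi> (\<Phi> x + t *\<^sub>R c)" v 0 x \<delta>]) auto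
qed

lemma subspace_tangent_space:
  assumes "x \<in> M" "x \<in> V"
  shows "subspace (tangent_space M x)" "dim (tangent_space M x) = k"
proof -
  have lin: "linear (blinfun_apply (\<Psi>' (\<Phi> x)))"
    by (simp add: blinfun.bounded_linear_right bounded_linear.linear)
  have inj: "inj_on (\<Psi>' (\<Phi> x)) (span L)"
    using \<Phi>'_\<Psi>'[OF assms(2)] by (rule inj_on_inverseI)
  show "subspace (tangent_space M x)"
    unfolding tangent_space_eq[OF assms] using linear_subspace_image[OF lin subspace_L] .
  show "dim (tangent_space M x) = k"
    unfolding tangent_space_eq[OF assms] dim_L[symmetric] using lin inj by (rule dim_image_eq)
qed

text \<open>A fixed basis of \<open>L\<close> pushed forward by \<open>\<Psi>'\<close> gives C^1
  fields on all of \<open>V\<close> that are tangent along \<open>M\<close>; Gram-Schmidt makes them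
  orthonormal without leaving their span.\<close>

lemma frame_exists: "\<exists>e. orthonormal_tangent_frame k M V e"
proof -
  obtain B where B: "B \<subseteq> L" "independent B" "card B = k"
    using basis_exists[of L] dim_L by metis
  have "finite B" using B(2) by (rule independent_imp_finite)
  then obtain b where b: "bij_betw b {..<k} B"
    using ex_bij_betw_nat_finite[of B] B(3) by (auto simp: atLeast0LessThan)
  define X where "X i x = \<Psi>' (\<Phi> x) (b i)" for i x
  obtain \<Psi>'' where \<Psi>'': "\<And>y. y \<in> W \<Longrightarrow> (\<Psi>' has_derivative blinfun_apply (\<Psi>'' y)) (at y)"
      "continuous_on W \<Psi>''"
    using C1_\<Psi>' unfolding C1_on_def by blast
  have c\<Phi>: "continuous_on V (\<lambda>x. \<Psi>'' (\<Phi> x))"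
    using homeo by (intro continuous_on_compose2[OF \<Psi>''(2)]) (auto simp: homeomorphism_def)
  have "C1_on V (X i)" for i
  proof (rule C1_onI)
    fix x assume x: "x \<in> V"
    have "((\<lambda>x. \<Psi>' (\<Phi> x)) has_derivative (\<lambda>h. \<Psi>'' (\<Phi> x) (\<Phi>' x h))) (at x)"
      using der_\<Phi>[OF x] \<Psi>''(1)[OF chart_maps(1)[OF x]] by (rule has_derivative_compose)
    from bounded_linear.has_derivative[OF blinfun.bounded_linear_left this]
    show "(X i has_derivative (\<lambda>h. \<Psi>'' (\<Phi> x) (\<Phi>' x h) (b i))) (at x)"
      unfolding X_def[abs_def] .
  next
    show "continuous_on V (\<lambda>x. \<Psi>'' (\<Phi> x) (\<Phi>' x h) (b i))" for h
      using c\<Phi> cont_\<Phi>' by (intro continuous_intros)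
  qed
  \<comment> \<open>A linear relation among the pushed vectors would pull back under the inverse
    \<open>\<Phi>' x\<close> to one within the basis \<open>B\<close>.\<close>
  moreover have "X i x \<notin> span ((\<lambda>j. X j x) ` {..<i})" if x: "x \<in> V" "i < k" for x i
  proof
    have lin: "linear (blinfun_apply (\<Psi>' (\<Phi> x)))"
      by (simp add: blinfun.bounded_linear_right bounded_linear.linear)
    assume "X i x \<in> span ((\<lambda>j. X j x) ` {..<i})"
    also have "(\<lambda>j. X j x) ` {..<i} = \<Psi>' (\<Phi> x) ` b ` {..<i}"
      by (auto simp: X_def)
    finally obtain u where u: "u \<in> span (b ` {..<i})" "\<Psi>' (\<Phi> x) (b i) = \<Psi>' (\<Phi> x) u"
      unfolding linear_span_image[OF lin] X_def by blast
    then have "b i \<in> span (b ` {..<i})" using \<Phi>'_\<Psi>'[OF x(1)] by metis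
    moreover have "b ` {..<i} \<subseteq> B - {b i}"
      using b x by (auto simp: bij_betw_def inj_on_def)
    ultimately have "b i \<in> span (B - {b i})" using span_mono by blast
    moreover have "b i \<in> B" using b x by (auto simp: bij_betw_def)
    ultimately show False using B(2) dependent_def by blast
  qed
  ultimately obtain e where e: "\<And>i. i < k \<Longrightarrow> C1_on V (e i)"
    "\<And>x i. x \<in> V \<Longrightarrow> i < k \<Longrightarrow> e i x \<in> span ((\<lambda>j. X j x) ` {..<k})"
    "\<And>x i j. x \<in> V \<Longrightarrow> i < k \<Longrightarrow> j < k \<Longrightarrow> e i x \<bullet> e j x = (if i = j then 1 else 0)"
    using C1_orthonormalization[of k V X] by blast
  have "e i x \<in> tangent_space M x" if "x \<in> M" "x \<in> V" "i < k" for i x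
  proof -
    have "X j x \<in> tangent_space M x" if "j < k" for j
      using tangent_space_eq[of x] \<open>x \<in> M\<close> \<open>x \<in> V\<close> B(1) b that
      by (auto simp: X_def bij_betw_def)
    then have "span ((\<lambda>j. X j x) ` {..<k}) \<subseteq> tangent_space M x"
      using subspace_tangent_space that by (intro span_minimal) auto
    then show ?thesis using e(2) that by blast
  qed
  then show ?thesis
    using e open_V unfolding orthonormal_tangent_frame_def by (intro exI[of _ e]) auto
qed

end

text \<open>The chart construction shows that the choice in \<open>frame_near\<close> is made from a
  nonempty set, so the chosen fields do form a frame.\<close>

lemma frame_near_frame:
  assumes "C2_submanifold k M" "p \<in> M"
  obtains V where "p \<in> V" "orthonormal_tangent_frame k M V (frame_near k M p)"
proof -
  obtain V W L \<Phi> \<Psi> \<Phi>' \<Psi>' where chart: "slice_chart k M V W L \<Phi> \<Psi> \<Phi>' \<Psi>'" and "p \<in> V"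
    using assms by (rule C2_submanifold_chart)
  with slice_chart.frame_exists[OF chart]
  have "\<exists>e V. p \<in> V \<and> orthonormal_tangent_frame k M V e" by blast
  from someI_ex[OF this, folded frame_near_def] show ?thesis
    by (elim exE conjE) (rule that)
qed

lemma orthonormal_tangent_frame_has_derivative:
  assumes "orthonormal_tangent_frame k M V e" "p \<in> V" "i < k"
  shows "(e i has_derivative frechet_derivative (e i) (at p)) (at p)"
proof -
  have "C1_on V (e i)" using assms by (simp add: orthonormal_tangent_frame_def)
  then have "e i differentiable (at p)"
    using assms(2) unfolding C1_on_def differentiable_def by blast
  then show ?thesis by (rule frechet_derivative_works[THEN iffD1])
qed

section \<open>Extremal points of |x| on a submanifold\<close>

text \<open>Along a curve in \<open>M\<close> through \<open>p\<close> the derivative of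
  \<open>s * |x|^2\<close> vanishes. Positive \<open>s\<close> covers maxima of |x| and negative
  \<open>s\<close> minima; where |x| is constant on \<open>M\<close>, every point qualifies.\<close>

lemma extremum_normal:
  assumes max: "\<And>x. x \<in> M \<Longrightarrow> s * (x \<bullet> x) \<le> s * (p \<bullet> p)" and "s \<noteq> 0"
  shows "p \<in> (tangent_space M p)\<^sup>\<bottom>"
proof -
  have "v \<bullet> p = 0" if "v \<in> tangent_space M p" for v
  proof -
    obtain \<gamma> where \<gamma>: "\<gamma> 0 = p" "\<And>t. \<gamma> t \<in> M" "(\<gamma> has_vector_derivative v) (at 0)"
      using \<open>v \<in> _\<close> unfolding tangent_space_def by blast
    have "DERIV (\<lambda>t. s * (\<gamma> t \<bullet> \<gamma> t)) 0 :> s * (2 * (v \<bullet> p))"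
      using \<gamma>(3) unfolding has_real_derivative_iff_has_vector_derivative has_vector_derivative_def
      by (auto intro!: derivative_eq_intros simp: \<gamma>(1) algebra_simps inner_commute)
    from DERIV_local_max[OF this, of 1] have "s * (2 * (v \<bullet> p)) = 0"
      using max \<gamma> by auto
    then show ?thesis using \<open>s \<noteq> 0\<close> by simp
  qed
  then show ?thesis by (auto simp: orthogonal_comp_def orthogonal_def)
qed

text \<open>To avoid integral curves of \<open>e\<^sub>i\<close> in \<open>M\<close>, the second derivative is taken along a \<open>C\<^sup>1\<close>
  chart curve. Expanding its velocity in the frame, each term of \<open>\<gamma>' \<bullet> \<gamma>\<close> is a product of a
  continuous coefficient and a differentiable factor vanishing at \<open>0\<close>, so \<open>\<gamma>''\<close> is not needed.\<close>

lemma extremum_second_order: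
  assumes M: "C2_submanifold k M" "p \<in> M"
    and max: "\<And>x. x \<in> M \<Longrightarrow> s * (x \<bullet> x) \<le> s * (p \<bullet> p)" and "s \<noteq> 0"
    and frame: "orthonormal_tangent_frame k M V e" "p \<in> V" and i: "i < k"
  shows "s * (flat_deriv (e i) (e i) p \<bullet> p + 1) \<le> 0"
proof -
  obtain V' W L \<Phi> \<Psi> \<Phi>' \<Psi>' where chart: "slice_chart k M V' W L \<Phi> \<Psi> \<Phi>' \<Psi>'" and p: "p \<in> V'"
    using M by (rule C2_submanifold_chart)
  interpret slice_chart k M V' W L \<Phi> \<Psi> \<Phi>' \<Psi>' by (fact chart)
  have e: "e j x \<in> tangent_space M x" if "x \<in> M" "x \<in> V" "j < k" for x j
    using frame(1) that unfolding orthonormal_tangent_frame_def by blast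
  have orth: "e j x \<bullet> e l x = (if j = l then 1 else 0)"
    if "x \<in> M" "x \<in> V" "j < k" "l < k" for x j l
    using frame(1) that unfolding orthonormal_tangent_frame_def by blast
  have "open V" using frame(1) unfolding orthonormal_tangent_frame_def by blast
  have e_p: "e j p \<in> tangent_space M p" if "j < k" for j
    using e[OF M(2) frame(2) that] .
  have "p \<in> (tangent_space M p)\<^sup>\<bottom>"
    using max \<open>s \<noteq> 0\<close> by (rule extremum_normal)
  then have normal: "e j p \<bullet> p = 0" if "j < k" for j
    using e_p[OF that] unfolding orthogonal_comp_def orthogonal_def by blast
  \<comment> \<open>\<open>c\<close> represents \<open>e i p\<close> in the chart, so the curve
    \<gamma> below starts with velocity \<open>e i p\<close>.\<close>
  obtain c where c: "c \<in> L" "e i p = \<Psi>' (\<Phi> p) c"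
    using e_p[OF i] unfolding tangent_space_eq[OF M(2) p] by blast
  define \<gamma> where "\<gamma> t = \<Psi> (\<Phi> p + t *\<^sub>R c)" for t
  define \<gamma>' where "\<gamma>' t = blinfun_apply (\<Psi>' (\<Phi> p + t *\<^sub>R c)) c" for t
  obtain \<delta> where "\<delta> > 0" "\<forall>t. \<bar>t\<bar> < \<delta> \<longrightarrow> \<Phi> p + t *\<^sub>R c \<in> W"
    "\<forall>t. \<bar>t\<bar> < \<delta> \<longrightarrow> \<gamma> t \<in> M"
    "\<forall>t. \<bar>t\<bar> < \<delta> \<longrightarrow> (\<gamma> has_vector_derivative \<gamma>' t) (at t)"
    by (rule chart_curve[OF M(2) p c(1), folded \<gamma>_def \<gamma>'_def])
  note \<delta> = this(1) this(2-)[rule_format]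
  have 0: "\<gamma> 0 = p" "\<gamma>' 0 = e i p" using c p by (simp_all add: \<gamma>_def \<gamma>'_def chart_maps)
  \<comment> \<open>Around time \<open>t\<close> the curve stays in \<open>M\<close> on an interval
    of radius \<open>\<delta> - |t|\<close>.\<close>
  have tan: "\<gamma>' t \<in> tangent_space M (\<gamma> t)" if "\<bar>t\<bar> < \<delta>" for t
    using that \<delta>(3,4) by (intro tangent_spaceI[of \<gamma> _ t _ "\<delta> - \<bar>t\<bar>"]) auto
  have "isCont \<gamma> 0" using \<delta>(1) \<delta>(4)[of 0] by (auto intro: has_vector_derivative_continuous)
  then have "\<forall>\<^sub>F t in nhds 0. \<gamma> t \<in> V"
    using \<open>open V\<close> frame(2) 0 by (auto simp: isCont_def tendsto_at_iff_tendsto_nhds dest: topological_tendstoD)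
  then obtain \<epsilon> where \<epsilon>: "\<epsilon> > 0" "\<And>t. \<bar>t\<bar> < \<epsilon> \<Longrightarrow> \<gamma> t \<in> V"
    unfolding eventually_nhds_metric by (auto simp: dist_real_def)
  define G where "G t = (\<Sum>j<k. (\<gamma>' t \<bullet> e j (\<gamma> t)) * (e j (\<gamma> t) \<bullet> \<gamma> t))" for t
  have G: "\<gamma>' t \<bullet> \<gamma> t = G t" if t: "\<bar>t\<bar> < min \<delta> \<epsilon>" for t
  proof -
    have "\<gamma> t \<in> M" "\<gamma> t \<in> V" "\<gamma> t \<in> V'"
      using \<delta> \<epsilon> t chart_maps(3) by (auto simp: \<gamma>_def)
    then have "\<gamma>' t = (\<Sum>j<k. (\<gamma>' t \<bullet> e j (\<gamma> t)) *\<^sub>R e j (\<gamma> t))"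
      using t tan e orth subspace_tangent_space
      by (intro orthonormal_expansion[where T = "tangent_space M (\<gamma> t)" and k = k]) auto
    then have "\<gamma>' t \<bullet> \<gamma> t = (\<Sum>j<k. (\<gamma>' t \<bullet> e j (\<gamma> t)) *\<^sub>R e j (\<gamma> t)) \<bullet> \<gamma> t" by simp
    then show ?thesis by (simp add: G_def inner_sum_left)
  qed
  have "isCont \<Psi>' (\<Phi> p + 0 *\<^sub>R c)"
    using continuous_on_eq_continuous_at[OF open_W] C1_on_imp_continuous_on[OF C1_\<Psi>']
      chart_maps(1)[OF p] by auto
  moreover have "isCont (\<lambda>t. \<Phi> p + t *\<^sub>R c) 0" by (intro continuous_intros)
  ultimately have "isCont (\<lambda>t. \<Psi>' (\<Phi> p + t *\<^sub>R c)) 0"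
    by (rule isCont_o2[rotated])
  then have cont': "isCont \<gamma>' 0"
    unfolding \<gamma>'_def[abs_def] by (rule bounded_linear.isCont[OF blinfun.bounded_linear_left])
  have dG: "DERIV G 0 :> flat_deriv (e i) (e i) p \<bullet> p + 1"
  proof -
    \<comment> \<open>The factor \<open>e j (\<gamma> t) \<bullet> \<gamma> t\<close> vanishes at 0
      because \<open>p\<close> is normal, and the coefficient there is
      \<open>e i p \<bullet> e j p\<close>. Hence only \<open>j = i\<close> contributes, and the 1
      is \<open>e i p \<bullet> e i p\<close>.\<close>
    have *: "DERIV (\<lambda>t. (\<gamma>' t \<bullet> e j (\<gamma> t)) * (e j (\<gamma> t) \<bullet> \<gamma> t)) 0 :>
       (if j = i then flat_deriv (e i) (e i) p \<bullet> p + 1 else 0)" if j: "j < k" for j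
    proof -
      note D = orthonormal_tangent_frame_has_derivative[OF frame j]
      have d: "((\<lambda>t. e j (\<gamma> t)) has_vector_derivative frechet_derivative (e j) (at p) (e i p)) (at 0)"
        using has_vector_derivative_compose[OF \<delta>(4)[of 0], unfolded 0, OF _ D] \<delta>(1) by simp
      then have "isCont (\<lambda>t. e j (\<gamma> t)) 0" by (rule has_vector_derivative_continuous)
      then have 1: "isCont (\<lambda>t. \<gamma>' t \<bullet> e j (\<gamma> t)) 0" using cont' by (intro continuous_intros)
      have 2: "DERIV (\<lambda>t. e j (\<gamma> t) \<bullet> \<gamma> t) 0 :>
          frechet_derivative (e j) (at p) (e i p) \<bullet> p + e j p \<bullet> e i p"
        using d \<delta>(4)[of 0] \<delta>(1) 0
        unfolding has_real_derivative_iff_has_vector_derivative has_vector_derivative_def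
        by (auto intro!: derivative_eq_intros simp: algebra_simps)
      show ?thesis
        using DERIV_mult_zero[OF 1 2] normal[OF j] orth[OF M(2) frame(2) i j] 0
        by (auto simp: flat_deriv_def split: if_splits)
    qed
    have "DERIV G 0 :> (\<Sum>j<k. if j = i then flat_deriv (e i) (e i) p \<bullet> p + 1 else 0)"
      unfolding G_def[abs_def] using * by (intro DERIV_sum) auto
    then show ?thesis using i by simp
  qed
  \<comment> \<open>\<open>G\<close> is the derivative of half the squared norm, hence the division
    by 2.\<close>
  show ?thesis
  proof (rule second_derivative_nonpos_at_max[of "min \<delta> \<epsilon>" "\<lambda>t. s * (\<gamma> t \<bullet> \<gamma> t) / 2" "\<lambda>t. s * G t"])
    show "DERIV (\<lambda>t. s * (\<gamma> t \<bullet> \<gamma> t) / 2) t :> s * G t" if "\<bar>t\<bar> < min \<delta> \<epsilon>" for t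
      using \<delta>(4)[of t] that G[OF that, symmetric]
      unfolding has_real_derivative_iff_has_vector_derivative has_vector_derivative_def
      by (auto intro!: derivative_eq_intros simp: algebra_simps inner_commute)
    show "s * (\<gamma> t \<bullet> \<gamma> t) / 2 \<le> s * (\<gamma> 0 \<bullet> \<gamma> 0) / 2" if "\<bar>t\<bar> < min \<delta> \<epsilon>" for t
      using max[OF \<delta>(3)[of t]] that 0 by simp
    show "DERIV (\<lambda>t. s * G t) 0 :> s * (flat_deriv (e i) (e i) p \<bullet> p + 1)"
      using dG by (rule DERIV_cmult)
  qed (use \<delta> \<epsilon> in auto)
qed

text \<open>Summing the second-order inequality over the \<open>k\<close> frame vectors yields
  \<open>H \<bullet> p + k\<close>, since \<open>p\<close> is normal and the projections drop out.
  The equation turns \<open>H \<bullet> p\<close> into \<alpha>, as \<open>p \<bullet> p\<close>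
  cancels the squared norm.\<close>

lemma stationary_extremum:
  assumes M: "C2_submanifold k M" "p \<in> M"
    and max: "\<And>x. x \<in> M \<Longrightarrow> s * (x \<bullet> x) \<le> s * (p \<bullet> p)" and "s \<noteq> 0"
    and stat: "stationary_eq k \<alpha> M p" and "p \<noteq> 0"
  shows "s * (\<alpha> + k) \<le> 0"
proof -
  define e where "e = frame_near k M p"
  obtain V where V: "p \<in> V" "orthonormal_tangent_frame k M V e"
    unfolding e_def using M by (rule frame_near_frame)
  note normal = normal_proj_normal[OF extremum_normal[OF max \<open>s \<noteq> 0\<close>]]
  have "mean_curvature k M p \<bullet> p = (\<Sum>i<k. flat_deriv (e i) (e i) p \<bullet> p)"
    by (simp add: mean_curvature_def Let_def e_def[symmetric] inner_sum_left normal)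
  moreover have "mean_curvature k M p \<bullet> p = \<alpha>"
    using stat \<open>p \<noteq> 0\<close> by (simp add: stationary_eq_def normal dot_square_norm)
  ultimately have "s * (\<alpha> + k) = (\<Sum>i<k. s * (flat_deriv (e i) (e i) p \<bullet> p + 1))"
    by (simp add: sum_distrib_left[symmetric] sum.distrib)
  also have "\<dots> \<le> 0"
    using extremum_second_order[OF M max \<open>s \<noteq> 0\<close> V(2,1)] by (intro sum_nonpos) auto
  finally show ?thesis .
qed

text \<open>Curves in a point are constant, whereas a frame with \<open>k > 0\<close> would contain
  a unit tangent vector. This excludes the origin as the farthest point of a compact
  \<open>M\<close>.\<close>

lemma C2_submanifold_not_singleton:
  assumes "C2_submanifold k {p}"
  shows "k = 0"
proof (rule ccontr)
  assume "k \<noteq> 0"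
  obtain V where "p \<in> V" "orthonormal_tangent_frame k {p} V (frame_near k {p} p)"
    using assms by (rule frame_near_frame) auto
  then have "frame_near k {p} p 0 p \<in> tangent_space {p} p" and 1: "frame_near k {p} p 0 p \<bullet> frame_near k {p} p 0 p = 1"
    using \<open>k \<noteq> 0\<close> unfolding orthonormal_tangent_frame_def by auto
  then obtain \<gamma> where "\<And>t. \<gamma> t = p" "(\<gamma> has_vector_derivative frame_near k {p} p 0 p) (at 0)"
    unfolding tangent_space_def by auto
  moreover from this have "\<gamma> = (\<lambda>_. p)" by auto
  ultimately have "frame_near k {p} p 0 p = 0"
    by (metis vector_derivative_unique_at has_vector_derivative_const)
  then show False using 1 by simp
qed

section \<open>Submanifolds of spheres\<close>

text \<open>The norm is constant on the sphere, which makes \<open>p\<close> normal; conversely a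
  vector orthogonal to \<open>p\<close> is the velocity of a line through \<open>p\<close> pushed
  radially back to the sphere.\<close>

lemma tangent_space_sphere:
  fixes p :: "'a::euclidean_space"
  assumes "norm p = R" "R > 0"
  shows "tangent_space (sphere 0 R) p = {p}\<^sup>\<bottom>"
proof (intro equalityI subsetI)
  fix v assume "v \<in> tangent_space (sphere 0 R) p"
  moreover have "p \<in> (tangent_space (sphere 0 R) p)\<^sup>\<bottom>"
    by (rule extremum_normal[of _ 1]) (simp_all add: dot_square_norm assms)
  ultimately show "v \<in> {p}\<^sup>\<bottom>" by (auto simp: orthogonal_comp_def orthogonal_commute)
next
  fix v assume "v \<in> {p}\<^sup>\<bottom>"
  then have v: "p \<bullet> v = 0" by (simp add: orthogonal_comp_def orthogonal_def)
  define \<gamma> where "\<gamma> t = (R * inverse (norm (p + t *\<^sub>R v))) *\<^sub>R (p + t *\<^sub>R v)" for t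
  \<comment> \<open>The pairing equals \<open>R^2\<close> at every time, so the line avoids the
    origin.\<close>
  have "(p + t *\<^sub>R v) \<bullet> p \<noteq> 0" for t
    using v assms by (auto simp: inner_add_left inner_commute[of v])
  then have nz: "p + t *\<^sub>R v \<noteq> 0" for t by (metis inner_zero_left)
  have line: "((\<lambda>t. p + t *\<^sub>R v) has_derivative (\<lambda>h. h *\<^sub>R v)) (at 0)"
    by (auto intro!: derivative_eq_intros)
  \<comment> \<open>As \<open>v\<close> is orthogonal to \<open>p\<close>, the norm is stationary at
    time 0, and rescaling leaves the velocity \<open>v\<close> unchanged.\<close>
  have n: "((\<lambda>t. norm (p + t *\<^sub>R v)) has_derivative (\<lambda>h. 0)) (at 0)"
    using has_derivative_compose[OF line has_derivative_norm[OF nz]] v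
    by (simp add: sgn_div_norm inner_commute)
  have "(\<gamma> has_vector_derivative v) (at 0)"
  proof -
    have "((\<lambda>t. inverse (norm (p + t *\<^sub>R v))) has_derivative (\<lambda>h. 0)) (at 0)"
      using Deriv.has_derivative_inverse[OF _ n] nz[of 0] by simp
    from has_derivative_mult_right[OF this, of R]
    have "((\<lambda>t. R * inverse (norm (p + t *\<^sub>R v))) has_derivative (\<lambda>h. 0)) (at 0)" by simp
    from has_derivative_scaleR[OF this line] show ?thesis
      using assms by (simp add: \<gamma>_def[abs_def] has_vector_derivative_def)
  qed
  moreover have "\<gamma> 0 = p" using assms by (simp add: \<gamma>_def)
  moreover have "\<gamma> t \<in> sphere 0 R" for t using nz[of t] assms by (simp add: \<gamma>_def)
  ultimately show "v \<in> tangent_space (sphere 0 R) p"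
    unfolding tangent_space_def by blast
qed

lemma orth_proj_hyperplane:
  fixes p :: "'a::euclidean_space"
  shows "orth_proj ({p}\<^sup>\<bottom>) w = w - ((w \<bullet> p) / (norm p)\<^sup>2) *\<^sub>R p"
proof (rule orth_proj_eqI[OF subspace_orthogonal_comp])
  \<comment> \<open>For \<open>p = 0\<close> the quotient is 0 and the complement is the whole
    space.\<close>
  show "w - ((w \<bullet> p) / (norm p)\<^sup>2) *\<^sub>R p \<in> {p}\<^sup>\<bottom>"
    by (cases "p = 0") (auto simp: orthogonal_comp_def orthogonal_def inner_diff_right dot_square_norm inner_commute)
qed (auto simp: orthogonal_comp_def orthogonal_def inner_commute[of _ p])

text \<open>The relation \<open>e i x \<bullet> x = 0\<close> holds along \<open>M\<close> only, so
  it is differentiated on a curve in \<open>M\<close> with velocity \<open>e i p\<close>; the value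
  -1 is minus the squared length of \<open>e i p\<close>.\<close>

lemma frame_deriv_in_sphere:
  assumes "M \<subseteq> sphere 0 R" "p \<in> M" "orthonormal_tangent_frame k M V e" "p \<in> V" "i < k"
  shows "flat_deriv (e i) (e i) p \<bullet> p = -1"
proof -
  have e: "e i x \<in> tangent_space M x" "e i x \<bullet> e i x = 1" if "x \<in> M" "x \<in> V" for x
    using assms(3,5) that unfolding orthonormal_tangent_frame_def by simp_all
  have "open V" using assms(3) unfolding orthonormal_tangent_frame_def by blast
  obtain \<gamma> where \<gamma>: "\<gamma> 0 = p" "\<And>t. \<gamma> t \<in> M" "(\<gamma> has_vector_derivative e i p) (at 0)"
    using e(1)[OF assms(2,4)] unfolding tangent_space_def by blast
  have "isCont \<gamma> 0" using \<gamma>(3) by (rule has_vector_derivative_continuous)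
  then have "\<forall>\<^sub>F t in nhds 0. \<gamma> t \<in> V"
    using \<open>open V\<close> assms(4) \<gamma>(1) by (auto simp: isCont_def tendsto_at_iff_tendsto_nhds dest: topological_tendstoD)
  then obtain S where S: "open S" "0 \<in> S" "\<And>t. t \<in> S \<Longrightarrow> \<gamma> t \<in> V"
    unfolding eventually_nhds by blast
  have orth: "e i x \<bullet> x = 0" if "x \<in> M" "x \<in> V" for x
  proof -
    have "y \<bullet> y = x \<bullet> x" if "y \<in> M" for y
      using assms(1) that \<open>x \<in> M\<close> by (auto simp: dot_square_norm subset_iff)
    then have "x \<in> (tangent_space M x)\<^sup>\<bottom>"
      by (intro extremum_normal[of _ 1]) auto
    then show ?thesis
      using e(1) that by (auto simp: orthogonal_comp_def orthogonal_def)
  qed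
  have "((\<lambda>t. e i (\<gamma> t)) has_vector_derivative flat_deriv (e i) (e i) p) (at 0)"
    using has_vector_derivative_compose[OF \<gamma>(3), unfolded \<gamma>(1)]
      orthonormal_tangent_frame_has_derivative[OF assms(3-5)]
    unfolding flat_deriv_def by blast
  then have "((\<lambda>t. e i (\<gamma> t) \<bullet> \<gamma> t) has_vector_derivative flat_deriv (e i) (e i) p \<bullet> p + 1) (at 0)"
    using \<gamma>(3) e(2)[OF assms(2,4)] \<gamma>(1)
    unfolding has_vector_derivative_def by (auto intro!: derivative_eq_intros simp: algebra_simps)
  moreover have "((\<lambda>t. e i (\<gamma> t) \<bullet> \<gamma> t) has_vector_derivative 0) (at 0)"
    by (rule has_vector_derivative_transform_within_open[OF has_vector_derivative_const S(1,2)])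
      (simp add: orth \<gamma>(2) S(3))
  ultimately have "flat_deriv (e i) (e i) p \<bullet> p + 1 = 0"
    by (rule vector_derivative_unique_at)
  then show ?thesis by simp
qed

text \<open>Projecting to the sphere removes the radial part \<open>- p / R^2\<close> of each
  \<open>flat_deriv (e i) (e i) p\<close>, and there are \<open>k\<close> of them. The correction is
  kept as \<open>normal_proj M p p\<close>, the shape of the right-hand side of
  \<open>stationary_eq\<close>.\<close>

lemma mean_curvature_in_sphere:
  assumes M: "C2_submanifold k M" "M \<subseteq> sphere 0 R" "p \<in> M" and "R > 0"
  shows "mean_curvature k M p =
    mean_curvature_in k (sphere 0 R) M p - (real k / R\<^sup>2) *\<^sub>R normal_proj M p p"
proof -
  define e where "e = frame_near k M p"
  obtain V where V: "p \<in> V" "orthonormal_tangent_frame k M V e"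
    unfolding e_def using M(1,3) by (rule frame_near_frame)
  have R: "norm p = R" using M by auto
  note lin = linear_normal_proj[of M p]
  have "normal_proj M p (flat_deriv (e i) (e i) p) =
      normal_proj M p (orth_proj (tangent_space (sphere 0 R) p) (flat_deriv (e i) (e i) p))
      - (1 / R\<^sup>2) *\<^sub>R normal_proj M p p" if "i < k" for i
    unfolding tangent_space_sphere[OF R \<open>R > 0\<close>] orth_proj_hyperplane
      frame_deriv_in_sphere[OF M(2,3) V(2,1) that] R
    by (simp add: linear_diff[OF lin] linear_add[OF lin] linear_cmul[OF lin])
  then show ?thesis
    by (simp add: mean_curvature_def mean_curvature_in_def Let_def e_def[symmetric]
        sum_subtractf scaleR_left_distrib sum_constant_scaleR)
qed

section \<open>The ranges \<alpha> > -k, \<alpha> = -k and \<alpha> < -k\<close>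

theorem theorem2p3:
  fixes \<alpha> :: real and k :: nat
  assumes "k \<ge> 1"
  shows "(\<alpha> > - real k \<longrightarrow>
            (\<forall>(M :: (real ^ 'n) set) U.
               U \<in> {UNIV, - {0}} \<and> C2_submanifold k M \<and> f_stationary k \<alpha> U M
               \<longrightarrow> \<not> compact M)) \<and>
         (\<alpha> = - real k \<longrightarrow>
            (\<forall>R > 0. \<forall>M :: (real ^ 'n) set.
               minimal_submanifold_of k (sphere 0 R) M
               \<longrightarrow> (\<forall>x\<in>M. stationary_eq k \<alpha> M x))) \<and>
         (\<alpha> < - real k \<longrightarrow>
            (\<forall>M :: (real ^ 'n) set.
               C2_submanifold k M \<and> M \<subseteq> - {0} \<and> f_stationary k \<alpha> (- {0}) M
               \<longrightarrow> 0 \<in> closure M))"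
proof (intro conjI impI allI ballI)
  fix M :: "(real ^ 'n) set" and U
  assume \<alpha>: "\<alpha> > - real k"
    and M: "U \<in> {UNIV, - {0}} \<and> C2_submanifold k M \<and> f_stationary k \<alpha> U M"
  show "\<not> compact M"
  proof
    assume "compact M"
    moreover have "M \<noteq> {}" using M by (simp add: C2_submanifold_def)
    moreover have "continuous_on M (\<lambda>x. x \<bullet> x)" by (intro continuous_intros)
    ultimately obtain p where p: "p \<in> M" "\<And>x. x \<in> M \<Longrightarrow> x \<bullet> x \<le> p \<bullet> p"
      using continuous_attains_sup[of M "\<lambda>x. x \<bullet> x"] by blast
    \<comment> \<open>\<open>f_stationary\<close> demands nothing at the origin, so the equation is
      available only at a nonzero maximum. A maximum of |x| at the origin would force
      \<open>M = {0}\<close>.\<close>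
    have "p \<noteq> 0"
    proof
      assume "p = 0"
      then have "x = 0" if "x \<in> M" for x
        using p(2)[OF that] inner_ge_zero[of x] by simp
      then have "M = {0}" using p(1) by blast
      then have "k = 0" using M C2_submanifold_not_singleton[of k "0 :: real ^ 'n"] by simp
      then show False using \<open>k \<ge> 1\<close> by simp
    qed
    moreover have "stationary_eq k \<alpha> M p"
      using M p \<open>p \<noteq> 0\<close> by (auto simp: f_stationary_def)
    ultimately show False
      using stationary_extremum[of k M p 1 \<alpha>] M p \<alpha> by auto
  qed
next
  fix R :: real and M :: "(real ^ 'n) set" and x
  assume \<alpha>: "\<alpha> = - real k" and "R > 0" and M: "minimal_submanifold_of k (sphere 0 R) M" and x: "x \<in> M"
  have sub: "C2_submanifold k M" "M \<subseteq> sphere 0 R" and H0: "mean_curvature_in k (sphere 0 R) M x = 0"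
    using M x unfolding minimal_submanifold_of_def by blast+
  have "norm x = R" using sub(2) x by auto
  \<comment> \<open>With zero curvature in the sphere only the correction term remains, and its
    factor \<open>- k / R^2\<close> is \<alpha> divided by the squared norm of
    \<open>x\<close>.\<close>
  then show "stationary_eq k \<alpha> M x"
    unfolding stationary_eq_def mean_curvature_in_sphere[OF sub x \<open>R > 0\<close>] H0 \<alpha> by simp
next
  fix M :: "(real ^ 'n) set"
  assume \<alpha>: "\<alpha> < - real k"
    and M: "C2_submanifold k M \<and> M \<subseteq> - {0} \<and> f_stationary k \<alpha> (- {0}) M"
  show "0 \<in> closure M"
  proof (rule ccontr)
    assume 0: "0 \<notin> closure M"
    have disj: "- {0} \<inter> (closure M - M) = {}"
      using M unfolding f_stationary_def by (elim conjE)
    \<comment> \<open>Stationarity away from the origin rules out limit points outside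
      \<open>M\<close> other than the origin, which is excluded by assumption.\<close>
    have "closure M \<subseteq> M"
    proof
      fix x assume x: "x \<in> closure M"
      then have "x \<noteq> 0" using 0 by metis
      then show "x \<in> M" using x disj by auto
    qed
    then have "closed M" by (simp only: closure_subset_eq)
    moreover have "M \<noteq> {}" using M by (simp add: C2_submanifold_def)
    \<comment> \<open>A nonempty closed set, bounded or not, has a point nearest to the
      origin.\<close>
    ultimately obtain p where p: "p \<in> M" "\<forall>x\<in>M. dist 0 p \<le> dist 0 x"
      by (rule distance_attains_inf) (rule that, assumption, blast)
    \<comment> \<open>The choice \<open>s = -1\<close> turns the minimum into the maximum required
      by \<open>stationary_extremum\<close>.\<close>
    have min: "- 1 * (x \<bullet> x) \<le> - 1 * (p \<bullet> p)" if "x \<in> M" for x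
      using p(2) that by (simp add: dot_square_norm)
    have "p \<noteq> 0" using M p(1) by blast
    moreover from this have "stationary_eq k \<alpha> M p"
      using M p(1) unfolding f_stationary_def by blast
    ultimately have "- 1 * (\<alpha> + k) \<le> 0"
      using M p(1) min by (intro stationary_extremum) auto
    then show False using \<alpha> by simp
  qed
qed

end
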